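(* Consider the stochastic trust-region algorithm described in the context, with $q>1$. Assume that $f$ is Lipschitz continuous with constant $L_f^*$ around any accumulation point of the sequence of iterates $\{X_k\}$. Let $K$ be the random set of indices of unsuccessful iterations. Suppose that: (a) there exists $\rho\in(0,1]$ such that $\|B_k\|\le\frac1\rho\frac{\|G_k\|}{\Delta_k}$ for every $k\in\mathbb{N}_0$; (b) for some $\varepsilon_q>0$ independent of $k$, for every $k$ and every $\alpha>0$, almost surely $$\mathbb{P}\left(|F_k-F_k^s-(f(X_k)-f(X_k+S_k))|\ge\alpha\|S_k\|^q\,\middle|\,\mathcal{F}_{k-1}\right)\le\frac{\varepsilon_q}{\alpha^{q/(q-1)}};$$ (c) $\displaystyle \theta>\frac{(\rho^q\tau_q^-+\tau_q^+)\,\varepsilon_q^{1/r(q)}}{\rho^q\tau_q^-}$, where $r(q)=\frac{q}{q-1}$. Then the following property holds almost surely: if $L\subset K$ is a random set such that $\{\hat S_k\}_{k\in L}$ is dense in the unit sphere and $\lim_{k\in L,\,k\to\infty}X_k=X^*$, then the point $X^*$ is Clarke stationary, i.e. $f^\circ(X^*,d)\ge0$ for every $d\in\mathbb{R}^n$.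
   Context: $f:\mathbb{R}^n\to\mathbb{R}$ is locally Lipschitz continuous (possibly non-smooth) with $\inf f=f^*\in\mathbb{R}$. Stochastic trust-region algorithm. Parameters: deterministic $x_0\in\mathbb{R}^n$, $\delta_0>0$, and $\theta>0$, $\tau\in(0,1)$, $\bar\tau\in[1,1+\tau]$, $q>1$. Set $X_0=x_0$, $\Delta_0=\delta_0$. For $k=0,1,\dots$: select a (random) vector $G_k\in\mathbb{R}^n$, $G_k\ne0$, and a (possibly random) symmetric matrix $B_k\in\mathbb{R}^{n\times n}$; compute $S_k\in\arg\min_{\|s\|\le\Delta_k}\,G_k^\top s+\frac12 s^\top B_ks$; compute random estimates $F_k$, $F_k^s$ of $f(X_k)$, $f(X_k+S_k)$; if $F_k-F_k^s\ge\theta\|S_k\|^q$ (successful iteration) set $X_{k+1}=X_k+S_k$, $\Delta_{k+1}=\bar\tau\Delta_k$; otherwise (unsuccessful iteration) set $X_{k+1}=X_k$, $\Delta_{k+1}=(1-\tau)\Delta_k$. $\mathcal{F}_{k-1}$ is the $\sigma$-algebra of events up to the generation of $B_k$ and $G_k$, i.e. generated by $(F_j,F_j^s)_{j=0}^{k-1}$ and $(G_j,B_j)_{j=0}^{k}$; the solution $S_k$ is computed from $G_k,B_k,\Delta_k$ so that it is $\mathcal{F}_{k-1}$-measurable. Constants: $\tau_q^+=(1+\tau)^q-1$, $\tau_q^-=1-(1-\tau)^q$. $\|B_k\|$ is the operator norm. For a vector $v$, $\hat v=v/\|v\|$ if $v\neq0$ and $\hat v=0$ if $v=0$. Clarke generalized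 directional derivative: $f^\circ(x,d)=\limsup_{y\to x,\,t\downarrow0}\frac{f(y+td)-f(y)}{t}$. A sequence $\{v_k\}_{k\in L}$ of unit vectors is called dense in the unit sphere if for every unit vector $d$ there is an infinite set $S\subset L$ with $\lim_{k\in S,\,k\to\infty}v_k=d$ (for $n\ge2$ this is the same as ordinary density of $\{v_k:k\in L\}$ in the sphere). *)

theory Defs
  imports "HOL-Probability.Probability"
begin

definition lipschitz_around :: "real \<Rightarrow> ('a::metric_space \<Rightarrow> real) \<Rightarrow> 'a \<Rightarrow> bool" where
  "lipschitz_around C f x \<longleftrightarrow> (\<exists>e>0. C-lipschitz_on (ball x e) f)"

definition locally_lipschitz :: "('a::metric_space \<Rightarrow> real) \<Rightarrow> bool" where
  "locally_lipschitz f \<longleftrightarrow> (\<forall>x. \<exists>C. lipschitz_around C f x)"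

text \<open>Accumulation points are those of the sequence (limits of subsequences), not limit points
  of its range: an eventually constant sequence has one.\<close>

definition accumulation_point :: "(nat \<Rightarrow> 'a::topological_space) \<Rightarrow> 'a \<Rightarrow> bool" where
  "accumulation_point u x \<longleftrightarrow> (\<exists>r. strict_mono r \<and> (u \<circ> r) \<longlonglongrightarrow> x)"

text \<open>The base point \<open>y\<close> ranges over full neighbourhoods of \<open>x\<close> (\<open>y = x\<close> is allowed), and the
  upper limit is taken in the extended reals.\<close>

definition clarke_derivative :: "('a::real_normed_vector \<Rightarrow> real) \<Rightarrow> 'a \<Rightarrow> 'a \<Rightarrow> ereal" where
  "clarke_derivative f x d =
     Limsup (nhds x \<times>\<^sub>F at_right 0) (\<lambda>(y, t). ereal ((f (y + t *\<^sub>R d) - f y) / t))"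

definition clarke_stationary :: "('a::real_normed_vector \<Rightarrow> real) \<Rightarrow> 'a \<Rightarrow> bool" where
  "clarke_stationary f x \<longleftrightarrow> (\<forall>d. 0 \<le> clarke_derivative f x d)"

text \<open>The filter of \<open>k \<rightarrow> \<infinity>\<close> with \<open>k\<close> restricted to \<open>S\<close>; it is trivial when \<open>S\<close> is finite.\<close>

definition along :: "nat set \<Rightarrow> nat filter" where
  "along S = inf sequentially (principal S)"

definition dense_in_unit_sphere :: "(nat \<Rightarrow> 'a::real_normed_vector) \<Rightarrow> nat set \<Rightarrow> bool" where
  "dense_in_unit_sphere v L \<longleftrightarrow>
     (\<forall>k\<in>L. norm (v k) = 1) \<and>
     (\<forall>d. norm d = 1 \<longrightarrow> (\<exists>S\<subseteq>L. infinite S \<and> (v \<longlongrightarrow> d) (along S)))"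

text \<open>\<open>past_algebra M F Fs G B k\<close> is the sigma-algebra written $\mathcal{F}_{k-1}$ on paper, generated
  by the estimates with index \<open>j < k\<close> and the models with index \<open>j \<le> k\<close>. The index is shifted
  by one, so that \<open>k = 0\<close> is $\mathcal{F}_{-1}$.\<close>

definition past_algebra ::
  "'w measure \<Rightarrow> (nat \<Rightarrow> 'w \<Rightarrow> real) \<Rightarrow> (nat \<Rightarrow> 'w \<Rightarrow> real) \<Rightarrow>
   (nat \<Rightarrow> 'w \<Rightarrow> real ^ 'n) \<Rightarrow> (nat \<Rightarrow> 'w \<Rightarrow> real ^ 'n ^ 'n) \<Rightarrow> nat \<Rightarrow> 'w measure" where
  "past_algebra M F Fs G B k = sigma (space M)
     ((\<Union>j<k. sets (vimage_algebra (space M) (\<lambda>\<omega>. (F j \<omega>, Fs j \<omega>)) borel)) \<union>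
      (\<Union>j\<le>k. sets (vimage_algebra (space M) (\<lambda>\<omega>. (G j \<omega>, B j \<omega>)) borel)))"

definition cond_prob_given :: "'w measure \<Rightarrow> 'w measure \<Rightarrow> ('w \<Rightarrow> bool) \<Rightarrow> 'w \<Rightarrow> real" where
  "cond_prob_given M \<A> P = real_cond_exp M \<A> (indicator {\<omega> \<in> space M. P \<omega>})"

definition successful ::
  "real \<Rightarrow> real \<Rightarrow> (nat \<Rightarrow> 'w \<Rightarrow> real) \<Rightarrow> (nat \<Rightarrow> 'w \<Rightarrow> real) \<Rightarrow> (nat \<Rightarrow> 'w \<Rightarrow> real ^ 'n) \<Rightarrow>
   nat \<Rightarrow> 'w \<Rightarrow> bool" where
  "successful \<theta> q F Fs S k \<omega> \<longleftrightarrow> F k \<omega> - Fs k \<omega> \<ge> \<theta> * norm (S k \<omega>) powr q"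

definition unsuccessful_indices ::
  "real \<Rightarrow> real \<Rightarrow> (nat \<Rightarrow> 'w \<Rightarrow> real) \<Rightarrow> (nat \<Rightarrow> 'w \<Rightarrow> real) \<Rightarrow> (nat \<Rightarrow> 'w \<Rightarrow> real ^ 'n) \<Rightarrow>
   'w \<Rightarrow> nat set" where
  "unsuccessful_indices \<theta> q F Fs S \<omega> = {k. \<not> successful \<theta> q F Fs S k \<omega>}"

text \<open>The objective function does not occur in the algorithm: it enters only through the estimates
  \<open>F k\<close> of \<open>f (X k)\<close> and \<open>Fs k\<close> of \<open>f (X k + S k)\<close>, whose accuracy is a separate hypothesis.\<close>

locale stochastic_trust_region = prob_space M for M :: "'w measure" +
  fixes x0 :: "real ^ 'n" and \<delta>0 \<theta> \<tau> \<tau>b q :: real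
    and X :: "nat \<Rightarrow> 'w \<Rightarrow> real ^ 'n" and \<Delta> :: "nat \<Rightarrow> 'w \<Rightarrow> real"
    and G :: "nat \<Rightarrow> 'w \<Rightarrow> real ^ 'n" and B :: "nat \<Rightarrow> 'w \<Rightarrow> real ^ 'n ^ 'n"
    and S :: "nat \<Rightarrow> 'w \<Rightarrow> real ^ 'n" and F Fs :: "nat \<Rightarrow> 'w \<Rightarrow> real"
  assumes params: "0 < \<delta>0" "0 < \<theta>" "0 < \<tau>" "\<tau> < 1" "1 \<le> \<tau>b" "\<tau>b \<le> 1 + \<tau>" "1 < q"
    and G_measurable: "\<And>k. G k \<in> borel_measurable M"
    and B_measurable: "\<And>k. B k \<in> borel_measurable M"
    and F_measurable: "\<And>k. F k \<in> borel_measurable M"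
    and Fs_measurable: "\<And>k. Fs k \<in> borel_measurable M"
    and S_measurable: "\<And>k. S k \<in> borel_measurable (past_algebra M F Fs G B k)"
    and X_0: "\<And>\<omega>. \<omega> \<in> space M \<Longrightarrow> X 0 \<omega> = x0"
    and \<Delta>_0: "\<And>\<omega>. \<omega> \<in> space M \<Longrightarrow> \<Delta> 0 \<omega> = \<delta>0"
    and G_nonzero: "\<And>k \<omega>. \<omega> \<in> space M \<Longrightarrow> G k \<omega> \<noteq> 0"
    and B_symmetric: "\<And>k \<omega>. \<omega> \<in> space M \<Longrightarrow> transpose (B k \<omega>) = B k \<omega>"
    and S_argmin: "\<And>k \<omega>. \<omega> \<in> space M \<Longrightarrow>
      is_arg_min (\<lambda>s. G k \<omega> \<bullet> s + 1 / 2 * (s \<bullet> (B k \<omega> *v s))) (\<lambda>s. norm s \<le> \<Delta> k \<omega>) (S k \<omega>)"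
    and X_Suc: "\<And>k \<omega>. \<omega> \<in> space M \<Longrightarrow>
      X (Suc k) \<omega> = (if successful \<theta> q F Fs S k \<omega> then X k \<omega> + S k \<omega> else X k \<omega>)"
    and \<Delta>_Suc: "\<And>k \<omega>. \<omega> \<in> space M \<Longrightarrow>
      \<Delta> (Suc k) \<omega> = (if successful \<theta> q F Fs S k \<omega> then \<tau>b * \<Delta> k \<omega> else (1 - \<tau>) * \<Delta> k \<omega>)"

definition tau_plus :: "real \<Rightarrow> real \<Rightarrow> real" where
  "tau_plus \<tau> q = (1 + \<tau>) powr q - 1"

definition tau_minus :: "real \<Rightarrow> real \<Rightarrow> real" where
  "tau_minus \<tau> q = 1 - (1 - \<tau>) powr q"

definition conj_exponent :: "real \<Rightarrow> real" where
  "conj_exponent q = q / (q - 1)"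

end

theory Submission
  imports Defs
begin

text \<open>At an unsuccessful iteration the trial point \<open>X k + S k\<close> is, up to the estimation error, not
much better than \<open>X k\<close>. If the steps tend to zero and the errors are of smaller order than the steps,
then the difference quotients of \<open>f\<close> at \<open>X k\<close> in the direction of \<open>S k\<close> are asymptotically nonnegative.
When the \<open>X k\<close> converge and the directions are dense, the Lipschitz property of \<open>f\<close> transfers this to every
direction at the limit point (\<open>clarke_stationary_of_dense_steps\<close>). It remains to prove, almost surely, that the
radii \<open>\<Delta> k\<close> tend to \<open>0\<close> and that the errors are \<open>o(norm (S k))\<close>. Write \<open>r = q / (q - 1)\<close> and
\<open>\<beta> = \<epsilon> powr (1 / r)\<close>.

For the radii, consider the Lyapunov function \<open>f (X k) + \<eta> (\<Delta> k)\<^sup>q\<close>. Let \<open>p\<close> be the conditional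
probability of success and let the true decrease be \<open>d\<close> times the \<open>q\<close>-th power of the step length. A success
with \<open>d < \<theta>\<close> requires a relative error of at least \<open>\<theta> - d\<close>, so the tail bound gives \<open>(\<theta> - d) p \<le> \<beta>\<close>
(\<open>success_prob_gain\<close>): the expected decrease of \<open>f\<close> is at least \<open>\<theta> p - \<beta>\<close> times the \<open>q\<close>-th power of the step
length, which lies between \<open>\<rho> \<Delta>\<close> and \<open>\<Delta>\<close> (\<open>trust_region_step_lower_bound\<close>). The lower bound on \<open>\<theta>\<close>
leaves room for an \<open>\<eta>\<close> with which the expectation of the Lyapunov function drops in every iteration by at
least a fixed positive multiple of that of \<open>\<Delta>\<^sup>q\<close> (\<open>expected_lyapunov_descent\<close>). As \<open>f\<close> is bounded below, the
expectations of \<open>\<Delta>\<^sup>q\<close> are summable, and \<open>\<Delta>\<close> tends to \<open>0\<close> almost surely.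

The same sum controls the errors: the tail bound with \<open>\<alpha> = m * norm S ^ (1 - q)\<close> bounds the probability
of \<open>\<bar>err\<bar> \<ge> m * norm S\<close> by a multiple of the expectation of \<open>\<Delta>\<^sup>q\<close>, because \<open>(q - 1) r = q\<close>, and the
Borel-Cantelli lemma applies (\<open>error_eventually_small\<close>).

Both arguments use the tail bound at a threshold that depends on the past, whereas it is assumed for
constant thresholds only; \<open>cond_prob_random_threshold\<close> closes this gap.\<close>

section \<open>Length of a trust-region step\<close>

text \<open>A minimiser on the boundary of the ball has length \<open>r\<close>. An interior one is a critical point of the
model, \<open>g + Q s = 0\<close>, so \<open>norm g \<le> onorm Q * norm s\<close>, and the curvature bound turns this into the
claim.\<close>

lemma trust_region_step_lower_bound:
  fixes g s :: "real ^ 'n" and Q :: "real ^ 'n ^ 'n"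
  assumes argmin: "is_arg_min (\<lambda>s. g \<bullet> s + 1 / 2 * (s \<bullet> (Q *v s))) (\<lambda>s. norm s \<le> r) s"
    and sym: "transpose Q = Q" and "g \<noteq> 0" and "0 < r" and "0 < \<rho>" "\<rho> \<le> 1"
    and bound: "onorm ((*v) Q) \<le> 1 / \<rho> * (norm g / r)"
  shows "\<rho> * r \<le> norm s"
proof (cases "norm s < r")
  case True
  define p where "p = g + Q *v s"
  \<comment> \<open>the model restricted to the line through \<open>s\<close> in the direction of its gradient \<open>p\<close>\<close>
  define m where "m t = g \<bullet> (s + t *\<^sub>R p) + 1 / 2 * ((s + t *\<^sub>R p) \<bullet> (Q *v (s + t *\<^sub>R p)))" for t
  have swap: "x \<bullet> (Q *v y) = (Q *v x) \<bullet> y" for x y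
    by (metis dot_lmul_matrix sym transpose_matrix_vector)
  have m_expand: "m t = m 0 + t * (p \<bullet> p) + t\<^sup>2 * (1 / 2 * (p \<bullet> (Q *v p)))" for t
  proof -
    have "p \<bullet> p = p \<bullet> (g + Q *v s)"
      by (simp only: p_def)
    then have pp: "p \<bullet> p = g \<bullet> p + p \<bullet> (Q *v s)"
      by (simp add: inner_add_right inner_commute)
    have sp: "s \<bullet> (Q *v p) = p \<bullet> (Q *v s)"
      using swap by (simp add: inner_commute)
    show ?thesis
      unfolding m_def pp
      by (simp add: inner_add_left inner_add_right matrix_vector_right_distrib
          matrix_vector_mult_scaleR sp power2_eq_square distrib_left mult.assoc)
  qed
  have "((\<lambda>t. m 0 + t * (p \<bullet> p) + t\<^sup>2 * (1 / 2 * (p \<bullet> (Q *v p))))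
      has_real_derivative p \<bullet> p) (at 0)"
    by (auto intro!: derivative_eq_intros)
  then have "(m has_real_derivative p \<bullet> p) (at 0)"
    by (subst (asm) m_expand[symmetric])
  moreover have "m 0 \<le> m t" if t: "\<bar>0 - t\<bar> < (r - norm s) / (norm p + 1)" for t
  proof -
    have "\<bar>t\<bar> * (norm p + 1) < r - norm s"
      using t by (simp add: field_simps add_pos_nonneg)
    then have "\<bar>t\<bar> * norm p < r - norm s"
      by (smt (verit) mult_left_mono norm_ge_zero abs_ge_zero)
    then have "norm (s + t *\<^sub>R p) \<le> r"
      using norm_triangle_ineq[of s "t *\<^sub>R p"] by simp
    then show ?thesis
      using argmin unfolding is_arg_min_def m_def by (auto simp: not_less)
  qed
  ultimately have "p \<bullet> p = 0"
    using True by (intro DERIV_local_min[of m _ 0 "(r - norm s) / (norm p + 1)"])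
      (auto simp: add_nonneg_pos)
  then have "norm g = norm (Q *v s)"
    by (metis add_eq_0_iff inner_eq_zero_iff norm_minus_cancel p_def)
  also have "\<dots> \<le> onorm ((*v) Q) * norm s"
    by (rule onorm) (rule matrix_vector_mul_bounded_linear)
  also have "\<dots> \<le> 1 / \<rho> * (norm g / r) * norm s"
    by (rule mult_right_mono[OF bound]) simp
  finally have "\<rho> * r * norm g \<le> norm s * norm g"
    using \<open>0 < \<rho>\<close> \<open>0 < r\<close> by (simp add: field_simps)
  then show ?thesis
    using \<open>g \<noteq> 0\<close> by simp
next
  case False
  then show ?thesis
    using \<open>\<rho> \<le> 1\<close> \<open>0 < r\<close> mult_right_mono[of \<rho> 1 r] by linarith
qed

section \<open>Clarke stationarity from vanishing steps\<close>

lemma filterlim_along_shrink: "filterlim u Z (along L) \<Longrightarrow> T \<subseteq> L \<Longrightarrow> filterlim u Z (along T)"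
  unfolding along_def by (rule filterlim_mono[of u Z]) (auto intro: inf_mono)

lemma along_neq_bot: "infinite T \<Longrightarrow> along T \<noteq> bot"
  unfolding along_def trivial_limit_def eventually_inf_principal
  by (auto simp: eventually_sequentially infinite_nat_iff_unbounded_le)

text \<open>Base points \<open>y k\<close> and step sizes \<open>t k\<close> tending, along any filter, to \<open>x\<close> and \<open>0+\<close> give a lower bound on the
upper limit that defines the Clarke derivative.\<close>

lemma clarke_derivative_nonneg_along:
  assumes nontrivial: "K \<noteq> bot" and y: "(y \<longlongrightarrow> x) K" and t: "filterlim t (at_right 0) K"
    and c: "(c \<longlongrightarrow> 0) K"
    and quotient: "eventually (\<lambda>k. c k \<le> (f (y k + t k *\<^sub>R d) - f (y k)) / t k) K"
  shows "0 \<le> clarke_derivative f x d"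
proof (rule ccontr)
  assume "\<not> 0 \<le> clarke_derivative f x d"
  then have "clarke_derivative f x d < 0" by simp
  then obtain b where b: "clarke_derivative f x d < ereal b" "b < 0"
    by (metis ereal_dense2 ereal_less_eq(3) less_ereal.simps(1) zero_ereal_def)
  have "eventually (\<lambda>(y, t). ereal ((f (y + t *\<^sub>R d) - f y) / t) < ereal b) (nhds x \<times>\<^sub>F at_right 0)"
    using Limsup_lessD[OF b(1)[unfolded clarke_derivative_def]]
    by (simp add: case_prod_unfold)
  moreover have "filterlim (\<lambda>k. (y k, t k)) (nhds x \<times>\<^sub>F at_right 0) K"
    using y t by (rule filterlim_Pair)
  ultimately have "eventually (\<lambda>k. (f (y k + t k *\<^sub>R d) - f (y k)) / t k < b) K"
    unfolding filterlim_iff by fastforce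
  moreover have "eventually (\<lambda>k. b < c k) K"
    using c \<open>b < 0\<close> by (rule order_tendstoD)
  ultimately have "eventually (\<lambda>k. False) K"
    using quotient by eventually_elim simp
  then show False
    using nontrivial by simp
qed

lemma clarke_derivative_zero_direction: "clarke_derivative f x 0 = 0"
proof -
  have "nhds x \<times>\<^sub>F at_right (0 :: real) \<noteq> bot"
    by (simp add: prod_filter_eq_bot)
  then show ?thesis
    unfolding clarke_derivative_def by (simp add: Limsup_const case_prod_unfold zero_ereal_def)
qed

text \<open>For a direction \<open>d \<noteq> 0\<close>, choose indices along which the unit vectors of the steps tend to \<open>sgn d\<close>, and
compare \<open>s k\<close> with the step \<open>t k * d\<close> of the same length in the exact direction \<open>d\<close>. The Lipschitz property
bounds the discrepancy of the values by \<open>C * norm (s k) * norm (sgn d - sgn (s k))\<close>, which like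
\<open>c k * norm (s k)\<close> is of smaller order than the step.\<close>

lemma clarke_stationary_of_dense_steps:
  fixes f :: "'a::real_normed_vector \<Rightarrow> real"
  assumes lip: "lipschitz_around C f x"
    and dense: "dense_in_unit_sphere (\<lambda>k. sgn (s k)) L"
    and y: "(y \<longlongrightarrow> x) (along L)"
    and s_nonzero: "\<And>k. s k \<noteq> 0" and s_null: "s \<longlonglongrightarrow> 0"
    and c_null: "c \<longlonglongrightarrow> 0" and small_decrease: "\<And>k. k \<in> L \<Longrightarrow> f (y k) - f (y k + s k) \<le> c k * norm (s k)"
  shows "clarke_stationary f x"
  unfolding clarke_stationary_def
proof
  fix d :: 'a
  show "0 \<le> clarke_derivative f x d"
  proof (cases "d = 0")
    case True
    then show ?thesis by (simp add: clarke_derivative_zero_direction)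
  next
    case False
    then have "norm (sgn d) = 1" by (simp add: norm_sgn)
    then obtain T where "T \<subseteq> L" "infinite T" and sgn_lim: "((\<lambda>k. sgn (s k)) \<longlongrightarrow> sgn d) (along T)"
      using dense unfolding dense_in_unit_sphere_def by blast
    define t where "t k = norm (s k) / norm d" for k
    have t_pos: "0 < t k" for k
      using False s_nonzero by (simp add: t_def)
    have to_T: "filterlim u Z sequentially \<Longrightarrow> filterlim u Z (along T)" for u :: "nat \<Rightarrow> 'z" and Z
      unfolding along_def by (rule filterlim_mono) auto
    have yT: "(y \<longlongrightarrow> x) (along T)"
      using y \<open>T \<subseteq> L\<close> by (rule filterlim_along_shrink)
    have sT: "(s \<longlongrightarrow> 0) (along T)" and cT: "(c \<longlongrightarrow> 0) (along T)"
      using s_null c_null by (auto intro: to_T)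
    have tT: "(t \<longlongrightarrow> 0) (along T)"
      unfolding t_def[abs_def] using tendsto_norm_zero[OF sT] by (rule tendsto_divide_zero)
    obtain e where "0 < e" and e: "C-lipschitz_on (ball x e) f"
      using lip unfolding lipschitz_around_def by blast
    have near: "eventually (\<lambda>k. z k \<in> ball x e) (along T)" if "(z \<longlongrightarrow> x) (along T)" for z
      using that \<open>0 < e\<close> by (metis centre_in_ball open_ball topological_tendstoD)
    have nearS: "eventually (\<lambda>k. y k + s k \<in> ball x e) (along T)"
      using near[OF tendsto_add[OF yT sT, simplified]] .
    have nearD: "eventually (\<lambda>k. y k + t k *\<^sub>R d \<in> ball x e) (along T)"
      using near[OF tendsto_add[OF yT tendsto_scaleR[OF tT tendsto_const[of d]], simplified]] .
    have inT: "eventually (\<lambda>k. k \<in> T) (along T)"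
      by (simp add: along_def eventually_inf_principal)
    show ?thesis
    proof (rule clarke_derivative_nonneg_along[of "along T" y x t
          "\<lambda>k. - (c k + C * norm (sgn d - sgn (s k))) * norm d"])
      show "along T \<noteq> bot" using \<open>infinite T\<close> by (rule along_neq_bot)
      show "(y \<longlongrightarrow> x) (along T)" by (rule yT)
      show "filterlim t (at_right 0) (along T)"
        unfolding filterlim_at using tT t_pos by (auto intro!: always_eventually simp: less_imp_neq[symmetric])
      have "((\<lambda>k. - (c k + C * norm (sgn d - sgn (s k))) * norm d) \<longlongrightarrow>
          - (0 + C * norm (sgn d - sgn d)) * norm d) (along T)"
        by (intro tendsto_intros cT sgn_lim)
      then show "((\<lambda>k. - (c k + C * norm (sgn d - sgn (s k))) * norm d) \<longlongrightarrow> 0) (along T)"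
        by simp
      show "eventually (\<lambda>k. - (c k + C * norm (sgn d - sgn (s k))) * norm d
          \<le> (f (y k + t k *\<^sub>R d) - f (y k)) / t k) (along T)"
        using nearS nearD inT
      proof eventually_elim
        case (elim k)
        have "t k *\<^sub>R d - s k = norm (s k) *\<^sub>R (sgn d - sgn (s k))"
          using s_nonzero[of k] by (simp add: t_def sgn_div_norm scaleR_diff_right divide_inverse)
        then have "norm (t k *\<^sub>R d - s k) = norm (s k) * norm (sgn d - sgn (s k))"
          by simp
        then have "dist (f (y k + t k *\<^sub>R d)) (f (y k + s k)) \<le> C * (norm (s k) * norm (sgn d - sgn (s k)))"
          using lipschitz_onD[OF e elim(2,1)] by (simp add: dist_norm)
        then have "f (y k + t k *\<^sub>R d) - f (y k)
            \<ge> - (c k * norm (s k)) - C * (norm (s k) * norm (sgn d - sgn (s k)))"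
          using small_decrease[of k] elim(3) \<open>T \<subseteq> L\<close> by (auto simp: dist_real_def)
        also have "- (c k * norm (s k)) - C * (norm (s k) * norm (sgn d - sgn (s k)))
            = - (c k + C * norm (sgn d - sgn (s k))) * norm d * t k"
          using False by (simp add: t_def algebra_simps)
        finally show ?case
          using t_pos[of k] by (simp add: pos_le_divide_eq)
      qed
    qed
  qed
qed

section \<open>Scalar estimates for the expected change\<close>

text \<open>The product is at most \<open>x\<close> and, by the tail bound, at most \<open>\<epsilon> * x powr (1 - r)\<close>. The first bound increases
with \<open>x\<close>, the second does not, and they cross at \<open>x = \<epsilon> powr (1 / r)\<close>.\<close>

lemma success_gain_bound:
  fixes p x \<epsilon> r :: real
  assumes p: "0 \<le> p" "p \<le> 1" and "0 < \<epsilon>" and "1 \<le> r"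
    and tail: "0 < x \<Longrightarrow> p \<le> \<epsilon> / x powr r"
  shows "x * p \<le> \<epsilon> powr (1 / r)"
proof (cases "x \<le> \<epsilon> powr (1 / r)")
  case True
  then show ?thesis
    using p by (smt (verit) mult_left_le mult_nonneg_nonneg mult_nonpos_nonneg powr_ge_zero)
next
  case False
  define \<beta> where "\<beta> = \<epsilon> powr (1 / r)"
  have \<beta>: "0 < \<beta>" "\<beta> powr r = \<epsilon>" "\<beta> < x"
    using \<open>0 < \<epsilon>\<close> \<open>1 \<le> r\<close> False by (auto simp: \<beta>_def powr_powr)
  have "x * p \<le> x * (\<beta> powr r / x powr r)"
    using \<beta> tail by (intro mult_left_mono) auto
  also have "\<dots> = \<beta> * (\<beta> powr (r - 1) / x powr (r - 1))"
    using \<beta> by (simp add: powr_diff)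
  also have "\<dots> \<le> \<beta> * 1"
    using \<beta> \<open>1 \<le> r\<close> by (intro mult_left_mono) (auto simp: divide_le_eq_1 intro: powr_mono2)
  finally show ?thesis
    by (simp add: \<beta>_def)
qed

text \<open>Here \<open>p\<close> is the probability of success, \<open>u\<close> and \<open>s\<close> are the \<open>q\<close>-th powers of the radius and of the step
length, and \<open>d * s\<close> is the true decrease of the objective. The left side is the expected change of
\<open>f + \<eta> u\<close> when success multiplies \<open>u\<close> by \<open>1 + a\<close> and failure by \<open>1 - b\<close>. The hypothesis \<open>gain\<close> gives
\<open>- d * p \<le> \<beta> - \<theta> * p = \<beta> * (1 - p) - (\<theta> - \<beta>) * p\<close>. The left side is thus dominated by a convex combination of
the two extreme cases, certain failure and certain success, and the minimum takes the worse of them.\<close>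

lemma expected_change_bound:
  fixes p u s d \<beta> \<theta> \<eta> a b \<kappa> :: real
  assumes p: "0 \<le> p" "p \<le> 1" and u: "0 \<le> u" and "0 \<le> \<kappa>" and s: "\<kappa> * u \<le> s" "s \<le> u"
    and gain: "(\<theta> - d) * p \<le> \<beta>" and \<beta>: "0 \<le> \<beta>" "\<beta> \<le> \<theta>"
  shows "p * (- d * s + \<eta> * a * u) - (1 - p) * (\<eta> * b * u)
    \<le> - min (\<eta> * b - \<beta>) (\<kappa> * (\<theta> - \<beta>) - \<eta> * a) * u" (is "_ \<le> - ?c * u")
proof -
  have "0 \<le> s"
    using s(1) u \<open>0 \<le> \<kappa>\<close> by (smt (verit) mult_nonneg_nonneg)
  have "- d * p \<le> \<beta> - \<theta> * p"
    using gain by (simp add: algebra_simps)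
  then have "p * (- d * s) \<le> s * (\<beta> * (1 - p)) - p * (s * (\<theta> - \<beta>))"
    using mult_right_mono[of "- d * p" "\<beta> - \<theta> * p" s] \<open>0 \<le> s\<close> by (simp add: algebra_simps)
  also have "\<dots> \<le> u * (\<beta> * (1 - p)) - p * (\<kappa> * u * (\<theta> - \<beta>))"
    using s p \<beta> by (intro diff_mono mult_right_mono mult_left_mono mult_nonneg_nonneg) auto
  finally have "p * (- d * s + \<eta> * a * u) - (1 - p) * (\<eta> * b * u)
      \<le> - ((1 - p) * ((\<eta> * b - \<beta>) * u) + p * ((\<kappa> * (\<theta> - \<beta>) - \<eta> * a) * u))"
    by (simp add: algebra_simps)
  also have "\<dots> \<le> - ((1 - p) * (?c * u) + p * (?c * u))"
    using p u by (intro le_imp_neg_le add_mono mult_left_mono mult_right_mono) auto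
  also have "\<dots> = - ?c * u"
    by (simp add: algebra_simps)
  finally show ?thesis .
qed

section \<open>Conditional tail bounds at random thresholds\<close>

lemma (in finite_measure_subalgebra) cond_prob_mono:
  assumes "{\<omega> \<in> space M. P \<omega>} \<in> sets M" "{\<omega> \<in> space M. Q \<omega>} \<in> sets M"
    and "\<And>\<omega>. \<omega> \<in> space M \<Longrightarrow> P \<omega> \<Longrightarrow> Q \<omega>"
  shows "AE \<omega> in M. cond_prob_given M F P \<omega> \<le> cond_prob_given M F Q \<omega>"
  unfolding cond_prob_given_def using assms
  by (intro real_cond_exp_mono) (auto simp: indicator_def less_top[symmetric])

lemma (in finite_measure_subalgebra) cond_prob_bounds:
  assumes "{\<omega> \<in> space M. P \<omega>} \<in> sets M"
  shows "AE \<omega> in M. 0 \<le> cond_prob_given M F P \<omega> \<and> cond_prob_given M F P \<omega> \<le> 1"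
proof -
  have "integrable M (indicator {\<omega> \<in> space M. P \<omega>} :: 'a \<Rightarrow> real)"
    using assms by (simp add: less_top[symmetric])
  then show ?thesis
    unfolding cond_prob_given_def
    by (intro AE_conjI real_cond_exp_ge_c real_cond_exp_le_c) (auto simp: indicator_def)
qed

text \<open>The exceptional null set of a tail bound may depend on the constant \<open>\<alpha>\<close>, so a threshold \<open>Y\<close> that varies
with \<open>\<omega>\<close> cannot simply be substituted for it. Countably many rational constants share one null set,
however. On the \<open>F\<close>-measurable event \<open>\<alpha> < Y\<close> the event \<open>Y * s \<le> Z\<close> is contained in \<open>\<alpha> * s \<le> Z\<close>, and
rational \<open>\<alpha>\<close> increasing to \<open>Y \<omega>\<close> give the bound by continuity of \<open>h\<close>.\<close>

lemma (in finite_measure_subalgebra) cond_prob_random_threshold: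
  fixes Z s Y :: "'a \<Rightarrow> real" and h :: "real \<Rightarrow> real"
  assumes Z[measurable]: "Z \<in> borel_measurable M"
    and s: "s \<in> borel_measurable F" and Y: "Y \<in> borel_measurable F"
    and s_nonneg: "\<And>\<omega>. \<omega> \<in> space M \<Longrightarrow> 0 \<le> s \<omega>"
    and h: "continuous_on {0<..} h"
    and tail: "\<And>\<alpha>. 0 < \<alpha> \<Longrightarrow> AE \<omega> in M. cond_prob_given M F (\<lambda>\<omega>. \<alpha> * s \<omega> \<le> Z \<omega>) \<omega> \<le> h \<alpha>"
  shows "AE \<omega> in M. 0 < Y \<omega> \<longrightarrow> cond_prob_given M F (\<lambda>\<omega>. Y \<omega> * s \<omega> \<le> Z \<omega>) \<omega> \<le> h (Y \<omega>)"
proof -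
  have sM[measurable]: "s \<in> borel_measurable M" and YM[measurable]: "Y \<in> borel_measurable M"
    using s Y by (auto intro: measurable_from_subalg[OF subalg])
  let ?E = "\<lambda>\<alpha>. {\<omega> \<in> space M. \<alpha> * s \<omega> \<le> Z \<omega>}" and ?EY = "{\<omega> \<in> space M. Y \<omega> * s \<omega> \<le> Z \<omega>}"
  have below: "AE \<omega> in M. \<alpha> < Y \<omega> \<longrightarrow> cond_prob_given M F (\<lambda>\<omega>. Y \<omega> * s \<omega> \<le> Z \<omega>) \<omega> \<le> h \<alpha>"
    if "0 < \<alpha>" for \<alpha>
  proof -
    define I :: "'a \<Rightarrow> real" where "I \<omega> = (if \<alpha> < Y \<omega> then 1 else 0)" for \<omega>
    have I_F: "I \<in> borel_measurable F"
      unfolding I_def[abs_def] using Y by measurable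
    then have [measurable]: "I \<in> borel_measurable M"
      by (rule measurable_from_subalg[OF subalg])
    have int: "integrable M (\<lambda>\<omega>. I \<omega> * indicator A \<omega>)" if [measurable]: "A \<in> sets M" for A
      by (rule integrable_const_bound[where B = 1]) (auto simp: I_def indicator_def)
    have le: "I \<omega> * indicator ?EY \<omega> \<le> I \<omega> * indicator (?E \<alpha>) \<omega>" for \<omega>
      using s_nonneg[of \<omega>] mult_right_mono[of \<alpha> "Y \<omega>" "s \<omega>"]
      by (auto simp: I_def indicator_def)
    have "AE \<omega> in M. real_cond_exp M F (\<lambda>\<omega>. I \<omega> * indicator ?EY \<omega>) \<omega>
        \<le> real_cond_exp M F (\<lambda>\<omega>. I \<omega> * indicator (?E \<alpha>) \<omega>) \<omega>"
      using le by (intro real_cond_exp_mono int) auto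
    moreover have "AE \<omega> in M. real_cond_exp M F (\<lambda>\<omega>. I \<omega> * indicator ?EY \<omega>) \<omega>
        = I \<omega> * real_cond_exp M F (indicator ?EY) \<omega>"
      by (intro real_cond_exp_mult int I_F) measurable
    moreover have "AE \<omega> in M. real_cond_exp M F (\<lambda>\<omega>. I \<omega> * indicator (?E \<alpha>) \<omega>) \<omega>
        = I \<omega> * real_cond_exp M F (indicator (?E \<alpha>)) \<omega>"
      by (intro real_cond_exp_mult int I_F) measurable
    moreover note tail[OF that]
    ultimately show ?thesis
      by eventually_elim (auto simp: I_def cond_prob_given_def split: if_splits)
  qed
  have "AE \<omega> in M. \<forall>\<alpha>\<in>{\<alpha>\<in>\<rat>. 0 < \<alpha>}. \<alpha> < Y \<omega> \<longrightarrow>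
      cond_prob_given M F (\<lambda>\<omega>. Y \<omega> * s \<omega> \<le> Z \<omega>) \<omega> \<le> h \<alpha>"
    using below countable_rat by (subst AE_ball_countable) (auto intro: countable_subset[of _ "\<rat>"])
  then show ?thesis
  proof eventually_elim
    case (elim \<omega>)
    let ?c = "cond_prob_given M F (\<lambda>\<omega>. Y \<omega> * s \<omega> \<le> Z \<omega>) \<omega>"
    show ?case
    proof (intro impI, rule ccontr)
      assume pos: "0 < Y \<omega>" and gt: "\<not> ?c \<le> h (Y \<omega>)"
      have "isCont h (Y \<omega>)"
        using h pos by (simp add: continuous_on_eq_continuous_at open_greaterThan)
      then have "eventually (\<lambda>\<alpha>. h \<alpha> < ?c) (at (Y \<omega>))"
        using gt unfolding isCont_def by (intro order_tendstoD) auto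
      then obtain e where "0 < e" and e: "\<And>\<alpha>. \<alpha> \<noteq> Y \<omega> \<Longrightarrow> dist \<alpha> (Y \<omega>) < e \<Longrightarrow> h \<alpha> < ?c"
        unfolding eventually_at by auto
      obtain \<alpha> where "\<alpha> \<in> \<rat>" "max 0 (Y \<omega> - e) < \<alpha>" "\<alpha> < Y \<omega>"
        using Rats_dense_in_real[of "max 0 (Y \<omega> - e)" "Y \<omega>"] pos \<open>0 < e\<close> by auto
      then show False
        using elim e[of \<alpha>] by (auto simp: dist_real_def not_le)
    qed
  qed
qed

section \<open>Measurability and boundedness of the iterates\<close>

context stochastic_trust_region
begin

abbreviation past :: "nat \<Rightarrow> 'w measure" where
  "past k \<equiv> past_algebra M F Fs G B k"

lemma space_past [simp]: "space (past k) = space M"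
  and sets_past: "sets (past k) = sigma_sets (space M)
    ((\<Union>j<k. sets (vimage_algebra (space M) (\<lambda>\<omega>. (F j \<omega>, Fs j \<omega>)) borel)) \<union>
     (\<Union>j\<le>k. sets (vimage_algebra (space M) (\<lambda>\<omega>. (G j \<omega>, B j \<omega>)) borel)))"
proof -
  let ?gen = "(\<Union>j<k. sets (vimage_algebra (space M) (\<lambda>\<omega>. (F j \<omega>, Fs j \<omega>)) borel)) \<union>
     (\<Union>j\<le>k. sets (vimage_algebra (space M) (\<lambda>\<omega>. (G j \<omega>, B j \<omega>)) borel))"
  have "?gen \<subseteq> Pow (space M)"
    by (auto dest!: sets.sets_into_space)
  then show "space (past k) = space M" "sets (past k) = sigma_sets (space M) ?gen"
    by (simp_all add: past_algebra_def)
qed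

lemma past_mono: "subalgebra (past (Suc k)) (past k)"
  unfolding subalgebra_def sets_past space_past
  by (intro conjI refl sigma_sets_mono' Un_mono UN_mono) auto

lemma subalgebra_past: "subalgebra M (past k)"
proof -
  have vimage: "sets (vimage_algebra (space M) g borel) \<subseteq> sets M" if "g \<in> borel_measurable M"
    for g :: "'w \<Rightarrow> 'z::topological_space"
    using that by (auto simp: sets_vimage_algebra2 measurable_def)
  have "sets (past k) \<subseteq> sets M"
    unfolding sets_past
    by (intro sets.sigma_sets_subset Un_least UN_least vimage borel_measurable_Pair
        F_measurable Fs_measurable G_measurable B_measurable)
  then show ?thesis
    by (simp add: subalgebra_def)
qed

sublocale past: finite_measure_subalgebra M "past k" for k
  by unfold_locales (rule subalgebra_past)

lemma past_estimates: "(\<lambda>\<omega>. F k \<omega> - Fs k \<omega>) \<in> borel_measurable (past (Suc k))"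
proof -
  have pair: "(\<lambda>\<omega>. (F k \<omega>, Fs k \<omega>)) \<in> borel_measurable (past (Suc k))"
  proof (rule measurableI)
    fix A :: "(real \<times> real) set" assume "A \<in> sets borel"
    then have "(\<lambda>\<omega>. (F k \<omega>, Fs k \<omega>)) -` A \<inter> space M
        \<in> sets (vimage_algebra (space M) (\<lambda>\<omega>. (F k \<omega>, Fs k \<omega>)) borel)"
      by (rule in_vimage_algebra)
    then show "(\<lambda>\<omega>. (F k \<omega>, Fs k \<omega>)) -` A \<inter> space (past (Suc k)) \<in> sets (past (Suc k))"
      unfolding sets_past space_past by (intro sigma_sets.Basic) auto
  qed simp
  have diff: "(\<lambda>(x, y). x - y) \<in> borel_measurable (borel :: (real \<times> real) measure)"
    by (intro borel_measurable_continuous_onI) (auto simp: case_prod_unfold intro!: continuous_intros)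
  show ?thesis
    using measurable_compose[OF pair diff] by simp
qed

lemma X_past: "X k \<in> borel_measurable (past k)"
proof (induction k)
  case 0
  then show ?case
    using X_0 by (subst measurable_cong[where g = "\<lambda>_. x0"]) auto
next
  case (Suc k)
  note [measurable] = measurable_from_subalg[OF past_mono Suc]
    measurable_from_subalg[OF past_mono S_measurable] past_estimates
  have "(\<lambda>\<omega>. if \<theta> * norm (S k \<omega>) powr q \<le> F k \<omega> - Fs k \<omega> then X k \<omega> + S k \<omega> else X k \<omega>)
      \<in> borel_measurable (past (Suc k))"
    by measurable
  then show ?case
    by (rule measurable_cong[THEN iffD1, rotated]) (simp add: X_Suc successful_def)
qed

lemma \<Delta>_past: "\<Delta> k \<in> borel_measurable (past k)"
proof (induction k)
  case 0
  then show ?case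
    using \<Delta>_0 by (subst measurable_cong[where g = "\<lambda>_. \<delta>0"]) auto
next
  case (Suc k)
  note [measurable] = measurable_from_subalg[OF past_mono Suc]
    measurable_from_subalg[OF past_mono S_measurable] past_estimates
  have "(\<lambda>\<omega>. if \<theta> * norm (S k \<omega>) powr q \<le> F k \<omega> - Fs k \<omega> then \<tau>b * \<Delta> k \<omega> else (1 - \<tau>) * \<Delta> k \<omega>)
      \<in> borel_measurable (past (Suc k))"
    by measurable
  then show ?case
    by (rule measurable_cong[THEN iffD1, rotated]) (simp add: \<Delta>_Suc successful_def)
qed

lemma random_variables [measurable]:
  "X k \<in> borel_measurable M" "\<Delta> k \<in> borel_measurable M" "S k \<in> borel_measurable M"
  "F k \<in> borel_measurable M" "Fs k \<in> borel_measurable M"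
  using X_past[of k] \<Delta>_past[of k] S_measurable[of k] F_measurable Fs_measurable
  by (blast intro: measurable_from_subalg[OF subalgebra_past[of k]])+

lemma \<Delta>_bounds: "\<omega> \<in> space M \<Longrightarrow> 0 < \<Delta> k \<omega> \<and> \<Delta> k \<omega> \<le> (1 + \<tau>) ^ k * \<delta>0"
proof (induction k)
  case (Suc k)
  then have "0 < \<Delta> k \<omega>" "\<Delta> k \<omega> \<le> (1 + \<tau>) ^ k * \<delta>0"
    by auto
  moreover have "c * \<Delta> k \<omega> \<le> (1 + \<tau>) * ((1 + \<tau>) ^ k * \<delta>0)" if "c \<le> 1 + \<tau>" for c
    using calculation that params by (intro mult_mono) auto
  ultimately show ?case
    using params Suc.prems by (auto simp: \<Delta>_Suc mult.assoc)
qed (use params in \<open>simp add: \<Delta>_0\<close>)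

lemma norm_S_le: "\<omega> \<in> space M \<Longrightarrow> norm (S k \<omega>) \<le> \<Delta> k \<omega>"
  using S_argmin[of \<omega> k] by (simp add: is_arg_min_def)

text \<open>The bound is deterministic for each \<open>k\<close>. This makes every \<open>f (X k)\<close> integrable for continuous \<open>f\<close>.\<close>

lemma X_bounded: "\<exists>R. \<forall>\<omega>\<in>space M. norm (X k \<omega>) \<le> R"
proof (induction k)
  case 0
  then show ?case using X_0 by auto
next
  case (Suc k)
  then obtain R where R: "\<forall>\<omega>\<in>space M. norm (X k \<omega>) \<le> R" by blast
  have "norm (X (Suc k) \<omega>) \<le> R + (1 + \<tau>) ^ k * \<delta>0" if "\<omega> \<in> space M" for \<omega>
    using R that norm_S_le[of \<omega> k] \<Delta>_bounds[of \<omega> k] norm_triangle_ineq[of "X k \<omega>" "S k \<omega>"]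
    by (fastforce simp: X_Suc)
  then show ?case by blast
qed

end

section \<open>Expected descent of the Lyapunov function\<close>

locale tail_bounded_trust_region =
  stochastic_trust_region M x0 \<delta>0 \<theta> \<tau> \<tau>b q X \<Delta> G B S F Fs
  for M :: "'w measure" and x0 :: "real ^ 'n" and \<delta>0 \<theta> \<tau> \<tau>b q X \<Delta> G B S F Fs +
  fixes f :: "real ^ 'n \<Rightarrow> real" and fstar \<rho> \<epsilon> :: real
  assumes f_cont: "continuous_on UNIV f"
    and f_below: "\<And>x. fstar \<le> f x"
    and \<rho>_range: "0 < \<rho>" "\<rho> \<le> 1"
    and curvature: "\<And>k. AE \<omega> in M. onorm ((*v) (B k \<omega>)) \<le> 1 / \<rho> * (norm (G k \<omega>) / \<Delta> k \<omega>)"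
    and \<epsilon>_pos: "0 < \<epsilon>"
    and tail: "\<And>k \<alpha>. 0 < \<alpha> \<Longrightarrow> AE \<omega> in M.
         cond_prob_given M (past_algebra M F Fs G B k)
           (\<lambda>\<omega>. \<bar>F k \<omega> - Fs k \<omega> - (f (X k \<omega>) - f (X k \<omega> + S k \<omega>))\<bar>
                  \<ge> \<alpha> * norm (S k \<omega>) powr q) \<omega>
         \<le> \<epsilon> / \<alpha> powr (conj_exponent q)"
    and \<theta>_large: "\<theta> > (\<rho> powr q * tau_minus \<tau> q + tau_plus \<tau> q) * \<epsilon> powr (1 / conj_exponent q)
             / (\<rho> powr q * tau_minus \<tau> q)"
begin

definition decrease :: "nat \<Rightarrow> 'w \<Rightarrow> real" where
  "decrease k \<omega> = f (X k \<omega>) - f (X k \<omega> + S k \<omega>)"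

definition err :: "nat \<Rightarrow> 'w \<Rightarrow> real" where
  "err k \<omega> = F k \<omega> - Fs k \<omega> - decrease k \<omega>"

lemma f_borel [measurable]: "f \<in> borel_measurable borel"
  using f_cont by (rule borel_measurable_continuous_onI)

lemma decrease_past: "decrease k \<in> borel_measurable (past k)"
proof -
  note [measurable] = X_past S_measurable
  show ?thesis unfolding decrease_def[abs_def] by measurable
qed

lemma decrease_measurable [measurable]: "decrease k \<in> borel_measurable M"
  using decrease_past by (rule measurable_from_subalg[OF subalgebra_past])

lemma err_measurable [measurable]: "err k \<in> borel_measurable M"
  unfolding err_def[abs_def] by measurable

lemma success_measurable [measurable]: "{\<omega> \<in> space M. successful \<theta> q F Fs S k \<omega>} \<in> sets M"
  unfolding successful_def by measurable

lemma step_lower: "AE \<omega> in M. \<forall>k. \<rho> * \<Delta> k \<omega> \<le> norm (S k \<omega>)"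
proof -
  have "AE \<omega> in M. \<rho> * \<Delta> k \<omega> \<le> norm (S k \<omega>)" for k
    using curvature[of k] AE_space
  proof eventually_elim
    case (elim \<omega>)
    then show ?case
      using trust_region_step_lower_bound[OF S_argmin B_symmetric G_nonzero _ \<rho>_range]
        \<Delta>_bounds[of \<omega> k] by blast
  qed
  then show ?thesis by (simp add: AE_all_countable)
qed

lemma step_nonzero: "AE \<omega> in M. \<forall>k. S k \<omega> \<noteq> 0"
  using step_lower AE_space
proof eventually_elim
  case (elim \<omega>)
  then have "0 < norm (S k \<omega>)" for k
    using \<Delta>_bounds[of \<omega> k] \<rho>_range mult_pos_pos[of \<rho> "\<Delta> k \<omega>"] by (meson less_le_trans)
  then show ?case by auto
qed

lemma integrable_f_of_bounded:
  assumes [measurable]: "V \<in> borel_measurable M" and "\<And>\<omega>. \<omega> \<in> space M \<Longrightarrow> norm (V \<omega>) \<le> R"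
  shows "integrable M (\<lambda>\<omega>. f (V \<omega>))"
proof -
  have "compact (f ` cball 0 R)"
    using f_cont by (intro compact_continuous_image) (auto intro: continuous_on_subset)
  then obtain C where C: "\<And>x. x \<in> cball 0 R \<Longrightarrow> norm (f x) \<le> C"
    unfolding bounded_iff[of "f ` _"] by (meson bounded_iff compact_imp_bounded imageI)
  show ?thesis
    using C assms(2) by (intro integrable_const_bound[where B = C] AE_I2) auto
qed

lemma integrable_f_X: "integrable M (\<lambda>\<omega>. f (X k \<omega>))"
  using X_bounded[of k] by (auto intro: integrable_f_of_bounded)

lemma integrable_decrease: "integrable M (decrease k)"
proof -
  obtain R where R: "\<And>\<omega>. \<omega> \<in> space M \<Longrightarrow> norm (X k \<omega>) \<le> R"
    using X_bounded by blast
  have "integrable M (\<lambda>\<omega>. f (X k \<omega> + S k \<omega>))"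
  proof (rule integrable_f_of_bounded)
    show "norm (X k \<omega> + S k \<omega>) \<le> R + (1 + \<tau>) ^ k * \<delta>0" if "\<omega> \<in> space M" for \<omega>
      using R[OF that] norm_S_le[OF that, of k] \<Delta>_bounds[OF that, of k]
        norm_triangle_ineq[of "X k \<omega>" "S k \<omega>"] by linarith
  qed measurable
  then show ?thesis
    unfolding decrease_def[abs_def] using integrable_f_X by auto
qed

lemma integrable_radius: "integrable M (\<lambda>\<omega>. \<Delta> k \<omega> powr q)"
proof (rule integrable_const_bound)
  show "AE \<omega> in M. norm (\<Delta> k \<omega> powr q) \<le> ((1 + \<tau>) ^ k * \<delta>0) powr q"
    using \<Delta>_bounds params by (intro AE_I2) (simp add: powr_mono2 less_imp_le)
qed measurable

lemma conj_exponent_ge_1: "1 \<le> conj_exponent q"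
  using params by (simp add: conj_exponent_def)

lemma tail_random:
  assumes Y: "Y \<in> borel_measurable (past k)"
  shows "AE \<omega> in M. 0 < Y \<omega> \<longrightarrow>
    cond_prob_given M (past k) (\<lambda>\<omega>. Y \<omega> * norm (S k \<omega>) powr q \<le> \<bar>err k \<omega>\<bar>) \<omega>
      \<le> \<epsilon> / Y \<omega> powr conj_exponent q"
proof (rule past.cond_prob_random_threshold[where h = "\<lambda>\<alpha>. \<epsilon> / \<alpha> powr conj_exponent q", OF _ _ Y])
  note [measurable] = S_measurable
  show "(\<lambda>\<omega>. norm (S k \<omega>) powr q) \<in> borel_measurable (past k)" by measurable
  show "continuous_on {0<..} (\<lambda>\<alpha>. \<epsilon> / \<alpha> powr conj_exponent q)"
    by (intro continuous_intros) auto
  show "AE \<omega> in M. cond_prob_given M (past k) (\<lambda>\<omega>. \<alpha> * norm (S k \<omega>) powr q \<le> \<bar>err k \<omega>\<bar>) \<omega>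
      \<le> \<epsilon> / \<alpha> powr conj_exponent q" if "0 < \<alpha>" for \<alpha>
    using tail[OF that] unfolding err_def decrease_def .
qed auto

definition success_prob :: "nat \<Rightarrow> 'w \<Rightarrow> real" where
  "success_prob k = cond_prob_given M (past k) (successful \<theta> q F Fs S k)"

text \<open>A successful iteration whose relative decrease \<open>d = decrease / norm S ^ q\<close> falls short of \<open>\<theta>\<close> owes its
success to an error of at least \<open>(\<theta> - d) * norm S ^ q\<close>. The threshold \<open>\<theta> - d\<close> is known from the past, hence
the tail bound at a random threshold applies.\<close>

lemma success_prob_gain:
  "AE \<omega> in M. (\<theta> - decrease k \<omega> / norm (S k \<omega>) powr q) * success_prob k \<omega>
    \<le> \<epsilon> powr (1 / conj_exponent q)"
proof -
  define Y where "Y \<omega> = \<theta> - decrease k \<omega> / norm (S k \<omega>) powr q" for \<omega>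
  have Y: "Y \<in> borel_measurable (past k)"
  proof -
    note [measurable] = S_measurable decrease_past
    show ?thesis unfolding Y_def[abs_def] by measurable
  qed
  note [measurable] = measurable_from_subalg[OF subalgebra_past Y]
  have "AE \<omega> in M. success_prob k \<omega>
      \<le> cond_prob_given M (past k) (\<lambda>\<omega>. Y \<omega> * norm (S k \<omega>) powr q \<le> \<bar>err k \<omega>\<bar>) \<omega>"
    unfolding success_prob_def
  proof (rule past.cond_prob_mono)
    fix \<omega>
    assume "successful \<theta> q F Fs S k \<omega>"
    then show "Y \<omega> * norm (S k \<omega>) powr q \<le> \<bar>err k \<omega>\<bar>"
      by (cases "S k \<omega> = 0") (auto simp: successful_def Y_def err_def left_diff_distrib)
  qed measurable
  moreover note tail_random[OF Y] past.cond_prob_bounds[OF success_measurable, of k k]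
  ultimately show ?thesis
  proof eventually_elim
    case (elim \<omega>)
    then show ?case
      using success_gain_bound[of "success_prob k \<omega>" \<epsilon> "conj_exponent q" "Y \<omega>"]
        \<epsilon>_pos conj_exponent_ge_1 by (auto simp: success_prob_def Y_def)
  qed
qed

text \<open>The weight \<open>\<eta>\<close> of the radius term has to meet two demands, with \<open>\<beta> = \<epsilon> powr (1 / r)\<close>. On failure the
shrinking of the radius must exceed the contribution of the errors, \<open>\<eta> * tau_minus > \<beta>\<close>, and on success
its growth must stay below the decrease of \<open>f\<close>, \<open>\<eta> * tau_plus < \<rho> powr q * (\<theta> - \<beta>)\<close>. The lower bound
on \<open>\<theta>\<close> says exactly that some \<open>\<eta>\<close> meets both.\<close>

lemma expected_lyapunov_descent:
  obtains \<eta> c where "0 < \<eta>" "0 < c"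
    "\<And>k. (\<integral>\<omega>. f (X (Suc k) \<omega>) + \<eta> * \<Delta> (Suc k) \<omega> powr q \<partial>M)
      \<le> (\<integral>\<omega>. f (X k \<omega>) + \<eta> * \<Delta> k \<omega> powr q \<partial>M) - c * (\<integral>\<omega>. \<Delta> k \<omega> powr q \<partial>M)"
proof -
  define \<beta> where "\<beta> = \<epsilon> powr (1 / conj_exponent q)"
  define \<kappa> where "\<kappa> = \<rho> powr q"
  let ?a = "tau_plus \<tau> q" and ?b = "tau_minus \<tau> q"
  have \<beta>: "0 < \<beta>" and \<kappa>: "0 < \<kappa>"
    using \<epsilon>_pos \<rho>_range by (auto simp: \<beta>_def \<kappa>_def)
  have a: "0 < ?a"
    using params by (simp add: tau_plus_def)
  have b: "0 < ?b"
    using params powr_less_mono2[of q "1 - \<tau>" 1] by (simp add: tau_minus_def)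
  have "(\<kappa> * ?b + ?a) * \<beta> / (\<kappa> * ?b) < \<theta>"
    using \<theta>_large by (simp add: \<kappa>_def \<beta>_def)
  then have "\<beta> / ?b < \<kappa> * (\<theta> - \<beta>) / ?a"
    using \<kappa> a b by (simp add: field_simps)
  then obtain \<eta> where \<eta>: "\<beta> / ?b < \<eta>" "\<eta> < \<kappa> * (\<theta> - \<beta>) / ?a"
    using dense by blast
  define c where "c = min (\<eta> * ?b - \<beta>) (\<kappa> * (\<theta> - \<beta>) - \<eta> * ?a)"
  have "0 < \<eta>"
    using \<eta>(1) \<beta> b by (meson divide_pos_pos less_trans)
  have "0 < c"
    using \<eta> a b by (simp add: c_def field_simps)
  have "0 < \<kappa> * (\<theta> - \<beta>)"
    using \<eta>(2) \<open>0 < \<eta>\<close> a by (smt (verit) divide_nonpos_pos)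
  then have "\<beta> \<le> \<theta>"
    using \<kappa> by (simp add: zero_less_mult_iff)
  have "(\<integral>\<omega>. f (X (Suc k) \<omega>) + \<eta> * \<Delta> (Suc k) \<omega> powr q \<partial>M)
      \<le> (\<integral>\<omega>. f (X k \<omega>) + \<eta> * \<Delta> k \<omega> powr q \<partial>M) - c * (\<integral>\<omega>. \<Delta> k \<omega> powr q \<partial>M)" for k
  proof -
    let ?u = "\<lambda>\<omega>. \<Delta> k \<omega> powr q" and ?s = "\<lambda>\<omega>. norm (S k \<omega>) powr q"
    let ?I = "indicator {\<omega> \<in> space M. successful \<theta> q F Fs S k \<omega>} :: 'w \<Rightarrow> real"
    \<comment> \<open>Bound on the change on success minus the change on failure, so that the Lyapunov function
      changes by at most \<open>W * ?I\<close> plus the change on failure. As \<open>W\<close> is known from the past, its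
      factor \<open>?I\<close> may be replaced by the conditional success probability under the integral.\<close>
    define W where "W \<omega> = - decrease k \<omega> + \<eta> * ?a * ?u \<omega> + \<eta> * ?b * ?u \<omega>" for \<omega>
    have W_past: "W \<in> borel_measurable (past k)"
    proof -
      note [measurable] = decrease_past \<Delta>_past
      show ?thesis unfolding W_def[abs_def] by measurable
    qed
    have W_int: "integrable M W"
      unfolding W_def[abs_def]
      by (intro Bochner_Integration.integrable_add integrable_minus integrable_mult_right
          integrable_decrease integrable_radius)
    have IW_int: "integrable M (\<lambda>\<omega>. W \<omega> * ?I \<omega>)"
      using W_int by (intro integrable_real_mult_indicator) auto
    note cond = past.real_cond_exp_intg[OF IW_int W_past, folded cond_prob_given_def,
        folded success_prob_def]
    note int = integrable_f_X integrable_radius IW_int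
    have "(\<integral>\<omega>. f (X (Suc k) \<omega>) + \<eta> * \<Delta> (Suc k) \<omega> powr q \<partial>M)
        \<le> (\<integral>\<omega>. f (X k \<omega>) + \<eta> * ?u \<omega> + (W \<omega> * ?I \<omega> - \<eta> * ?b * ?u \<omega>) \<partial>M)"
    proof (rule integral_mono)
      fix \<omega> assume \<omega>: "\<omega> \<in> space M"
      have "(\<tau>b * \<Delta> k \<omega>) powr q \<le> (1 + \<tau>) powr q * ?u \<omega>"
        using params \<Delta>_bounds[OF \<omega>, of k] by (simp add: powr_mult mult_right_mono powr_mono2)
      then have "\<eta> * (\<tau>b * \<Delta> k \<omega>) powr q \<le> \<eta> * ((1 + \<tau>) powr q * ?u \<omega>)"
        using \<open>0 < \<eta>\<close> by simp
      moreover have "((1 - \<tau>) * \<Delta> k \<omega>) powr q = (1 - \<tau>) powr q * ?u \<omega>"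
        using params \<Delta>_bounds[OF \<omega>, of k] by (simp add: powr_mult)
      ultimately show "f (X (Suc k) \<omega>) + \<eta> * \<Delta> (Suc k) \<omega> powr q
          \<le> f (X k \<omega>) + \<eta> * ?u \<omega> + (W \<omega> * ?I \<omega> - \<eta> * ?b * ?u \<omega>)"
        using \<omega> by (simp add: X_Suc \<Delta>_Suc W_def decrease_def tau_plus_def tau_minus_def algebra_simps)
    qed (intro Bochner_Integration.integrable_add Bochner_Integration.integrable_diff
        integrable_mult_right int)+
    also have "\<dots> = (\<integral>\<omega>. f (X k \<omega>) + \<eta> * ?u \<omega> \<partial>M) +
        (\<integral>\<omega>. W \<omega> * success_prob k \<omega> - \<eta> * ?b * ?u \<omega> \<partial>M)"
      using int cond by simp
    also have "(\<integral>\<omega>. W \<omega> * success_prob k \<omega> - \<eta> * ?b * ?u \<omega> \<partial>M) \<le> (\<integral>\<omega>. - c * ?u \<omega> \<partial>M)"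
    proof (rule integral_mono_AE)
      have "AE \<omega> in M. 0 \<le> success_prob k \<omega> \<and> success_prob k \<omega> \<le> 1"
        unfolding success_prob_def by (rule past.cond_prob_bounds) simp
      then show "AE \<omega> in M. W \<omega> * success_prob k \<omega> - \<eta> * ?b * ?u \<omega> \<le> - c * ?u \<omega>"
        using success_prob_gain[of k] step_lower step_nonzero AE_space
      proof eventually_elim
        case (elim \<omega>)
        have "\<kappa> * ?u \<omega> = (\<rho> * \<Delta> k \<omega>) powr q"
          using \<Delta>_bounds[OF elim(5), of k] \<rho>_range by (simp add: \<kappa>_def powr_mult)
        also have "\<dots> \<le> ?s \<omega>"
          using elim \<Delta>_bounds[OF elim(5), of k] \<rho>_range params by (intro powr_mono2) auto
        finally have lower: "\<kappa> * ?u \<omega> \<le> ?s \<omega>" .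
        have upper: "?s \<omega> \<le> ?u \<omega>"
          using norm_S_le[OF elim(5), of k] params by (intro powr_mono2) auto
        have "W \<omega> * success_prob k \<omega> - \<eta> * ?b * ?u \<omega>
          = success_prob k \<omega> * (- (decrease k \<omega> / ?s \<omega>) * ?s \<omega> + \<eta> * ?a * ?u \<omega>)
            - (1 - success_prob k \<omega>) * (\<eta> * ?b * ?u \<omega>)"
          using elim(4) by (simp add: W_def algebra_simps)
        also have "\<dots> \<le> - c * ?u \<omega>"
          unfolding c_def using elim lower upper \<kappa> \<beta> \<open>\<beta> \<le> \<theta>\<close>
          by (intro expected_change_bound) (auto simp: \<beta>_def)
        finally show ?case .
      qed
    qed (use cond(1) integrable_radius[of k] in auto)
    finally show ?thesis by simp
  qed
  with \<open>0 < \<eta>\<close> \<open>0 < c\<close> show thesis by (rule that)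
qed

text \<open>The Lyapunov function is bounded below, so the expected decreases have a finite sum.\<close>

lemma summable_expected_radius: "summable (\<lambda>k. \<integral>\<omega>. \<Delta> k \<omega> powr q \<partial>M)"
proof -
  obtain \<eta> c where "0 < \<eta>" "0 < c" and descent:
    "\<And>k. (\<integral>\<omega>. f (X (Suc k) \<omega>) + \<eta> * \<Delta> (Suc k) \<omega> powr q \<partial>M)
      \<le> (\<integral>\<omega>. f (X k \<omega>) + \<eta> * \<Delta> k \<omega> powr q \<partial>M) - c * (\<integral>\<omega>. \<Delta> k \<omega> powr q \<partial>M)"
    by (rule expected_lyapunov_descent) blast
  define \<Phi> where "\<Phi> k = (\<integral>\<omega>. f (X k \<omega>) + \<eta> * \<Delta> k \<omega> powr q \<partial>M)" for k
  have telescope: "\<Phi> n + c * (\<Sum>k<n. \<integral>\<omega>. \<Delta> k \<omega> powr q \<partial>M) \<le> \<Phi> 0" for n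
  proof (induction n)
    case (Suc n)
    then show ?case using descent[of n] by (simp add: \<Phi>_def algebra_simps)
  qed simp
  have "(\<integral>\<omega>. fstar \<partial>M) \<le> \<Phi> n" for n
    unfolding \<Phi>_def
    by (intro integral_mono Bochner_Integration.integrable_add integrable_mult_right
        integrable_f_X integrable_radius)
      (use f_below \<open>0 < \<eta>\<close> in \<open>auto intro!: add_increasing2\<close>)
  then have "(\<Sum>k<n. \<integral>\<omega>. \<Delta> k \<omega> powr q \<partial>M) \<le> (\<Phi> 0 - fstar) / c" for n
    using telescope[of n] \<open>0 < c\<close> by (simp add: field_simps prob_space) (smt (verit))
  then show ?thesis
    by (intro summableI_nonneg_bounded) auto
qed

section \<open>Almost sure behaviour of radii and errors\<close>

lemma radius_tendsto_0: "AE \<omega> in M. (\<lambda>k. \<Delta> k \<omega>) \<longlonglongrightarrow> 0"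
proof -
  have "(\<integral>\<^sup>+\<omega>. (\<Sum>k. ennreal (\<Delta> k \<omega> powr q)) \<partial>M) = (\<Sum>k. \<integral>\<^sup>+\<omega>. ennreal (\<Delta> k \<omega> powr q) \<partial>M)"
    by (rule nn_integral_suminf) measurable
  also have "\<dots> = (\<Sum>k. ennreal (\<integral>\<omega>. \<Delta> k \<omega> powr q \<partial>M))"
    using integrable_radius by (simp add: nn_integral_eq_integral)
  also have "\<dots> \<noteq> \<infinity>"
    using summable_expected_radius by (simp add: suminf_ennreal2)
  finally have "AE \<omega> in M. (\<Sum>k. ennreal (\<Delta> k \<omega> powr q)) \<noteq> \<infinity>"
    by (intro nn_integral_noteq_infinite) auto
  then show ?thesis
    using AE_space
  proof eventually_elim
    case (elim \<omega>)
    then have "summable (\<lambda>k. \<Delta> k \<omega> powr q)"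
      by (intro summable_suminf_not_top) auto
    then have "(\<lambda>k. \<Delta> k \<omega> powr q) \<longlonglongrightarrow> 0"
      by (rule summable_LIMSEQ_zero)
    then have "(\<lambda>k. (\<Delta> k \<omega> powr q) powr (1 / q)) \<longlonglongrightarrow> 0"
      by (rule tendsto_zero_powrI[OF _ tendsto_const]) (use params in auto)
    moreover have "(\<Delta> k \<omega> powr q) powr (1 / q) = \<Delta> k \<omega>" for k
      using \<Delta>_bounds[OF elim(2), of k] params by (simp add: powr_powr)
    ultimately show ?case
      by (simp only:)
  qed
qed

text \<open>The threshold \<open>m * norm S ^ (1 - q)\<close> turns the bound on \<open>\<bar>err\<bar> \<ge> \<alpha> * norm S ^ q\<close> into one on
\<open>\<bar>err\<bar> \<ge> m * norm S\<close>. Since \<open>(q - 1) * r = q\<close>, the resulting probability is at most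
\<open>\<epsilon> * m powr (- r)\<close> times the expectation of \<open>\<Delta>\<^sup>q\<close>. This is summable over \<open>k\<close>, and the Borel-Cantelli
lemma applies.\<close>

lemma error_eventually_small:
  assumes "0 < m"
  shows "AE \<omega> in M. eventually (\<lambda>k. \<bar>err k \<omega>\<bar> < m * norm (S k \<omega>)) sequentially"
proof -
  define r where "r = conj_exponent q"
  define E where "E k = {\<omega> \<in> space M. m * norm (S k \<omega>) \<le> \<bar>err k \<omega>\<bar>}" for k
  have [measurable]: "E k \<in> sets M" for k
    unfolding E_def by measurable
  have "measure M (E k) \<le> \<epsilon> / m powr r * (\<integral>\<omega>. \<Delta> k \<omega> powr q \<partial>M)" for k
  proof -
    define Y where "Y \<omega> = m * norm (S k \<omega>) powr (1 - q)" for \<omega>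
    have Y: "Y \<in> borel_measurable (past k)"
    proof -
      note [measurable] = S_measurable
      show ?thesis unfolding Y_def[abs_def] by measurable
    qed
    let ?p = "cond_prob_given M (past k) (\<lambda>\<omega>. Y \<omega> * norm (S k \<omega>) powr q \<le> \<bar>err k \<omega>\<bar>)"
    \<comment> \<open>also valid where \<open>S k = 0\<close>, since powers of \<open>0\<close> are \<open>0\<close>\<close>
    have E_eq: "E k = {\<omega> \<in> space M. Y \<omega> * norm (S k \<omega>) powr q \<le> \<bar>err k \<omega>\<bar>}"
      unfolding E_def Y_def by (auto simp: mult.assoc powr_add[symmetric])
    have int: "integrable M (indicator (E k) :: 'w \<Rightarrow> real)"
      by (simp add: less_top[symmetric])
    have "measure M (E k) = (\<integral>\<omega>. indicator (E k) \<omega> \<partial>M)"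
      by simp
    also have "\<dots> = (\<integral>\<omega>. ?p \<omega> \<partial>M)"
      using past.real_cond_exp_int(2)[OF int, of k] by (simp add: cond_prob_given_def E_eq)
    also have "\<dots> \<le> (\<integral>\<omega>. \<epsilon> / m powr r * \<Delta> k \<omega> powr q \<partial>M)"
    proof (rule integral_mono_AE)
      show "integrable M ?p"
        using past.real_cond_exp_int(1)[OF int, of k] by (simp add: cond_prob_given_def E_eq)
      show "AE \<omega> in M. ?p \<omega> \<le> \<epsilon> / m powr r * \<Delta> k \<omega> powr q"
        using tail_random[OF Y] step_nonzero AE_space
      proof eventually_elim
        case (elim \<omega>)
        have "(1 - q) * r = - q"
          using params by (simp add: r_def conj_exponent_def field_simps)
        then have "Y \<omega> powr r = m powr r * norm (S k \<omega>) powr (- q)"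
          using \<open>0 < m\<close> by (simp add: Y_def powr_mult powr_powr)
        then have "\<epsilon> / Y \<omega> powr r = \<epsilon> / m powr r * norm (S k \<omega>) powr q"
          by (simp add: powr_minus divide_inverse)
        moreover have "0 < Y \<omega>"
          using elim \<open>0 < m\<close> by (simp add: Y_def)
        ultimately have "?p \<omega> \<le> \<epsilon> / m powr r * norm (S k \<omega>) powr q"
          using elim(1) by (simp add: r_def)
        also have "\<dots> \<le> \<epsilon> / m powr r * \<Delta> k \<omega> powr q"
          using norm_S_le[OF elim(3), of k] params \<epsilon>_pos
          by (intro mult_left_mono powr_mono2) auto
        finally show ?case .
      qed
    qed (use integrable_radius in auto)
    finally show ?thesis by simp
  qed
  then have "summable (\<lambda>k. measure M (E k))"
    by (intro summable_comparison_test'[OF summable_mult[OF summable_expected_radius], of 0 _ "\<epsilon> / m powr r"])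
      auto
  then have "AE \<omega> in M. eventually (\<lambda>k. \<omega> \<in> space M - E k) sequentially"
    by (intro borel_cantelli_AE1) (auto simp: less_top[symmetric])
  then show ?thesis
    by eventually_elim (auto simp: E_def not_le elim: eventually_mono)
qed

lemma error_negligible: "AE \<omega> in M. (\<lambda>k. \<bar>err k \<omega>\<bar> / norm (S k \<omega>)) \<longlonglongrightarrow> 0"
proof -
  have "AE \<omega> in M. \<forall>j::nat. eventually (\<lambda>k. \<bar>err k \<omega>\<bar> < 1 / Suc j * norm (S k \<omega>)) sequentially"
    unfolding AE_all_countable by (intro allI error_eventually_small) simp
  then show ?thesis
    using step_nonzero
  proof eventually_elim
    case (elim \<omega>)
    show ?case
    proof (rule tendstoI)
      fix e :: real assume "0 < e"
      then obtain j where j: "1 / Suc j < e"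
        using nat_approx_posE by blast
      have "eventually (\<lambda>k. \<bar>err k \<omega>\<bar> < 1 / Suc j * norm (S k \<omega>)) sequentially"
        using elim by blast
      then show "eventually (\<lambda>k. dist (\<bar>err k \<omega>\<bar> / norm (S k \<omega>)) 0 < e) sequentially"
      proof eventually_elim
        case (elim k)
        then have "\<bar>err k \<omega>\<bar> / norm (S k \<omega>) < 1 / Suc j"
          using \<open>\<forall>k. S k \<omega> \<noteq> 0\<close> by (simp add: pos_divide_less_eq del: of_nat_Suc)
        then show ?case using j by (simp del: of_nat_Suc)
      qed
    qed
  qed
qed

section \<open>Stationarity of limits of unsuccessful iterates\<close>

text \<open>Failure of the acceptance test implies \<open>decrease < \<theta> * norm S ^ q + \<bar>err\<bar>\<close>. As \<open>q > 1\<close> and the steps vanish, both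
terms are of smaller order than \<open>norm S\<close>.\<close>

lemma clarke_stationary_limits:
  assumes "locally_lipschitz f"
  shows "AE \<omega> in M. \<forall>L xstar.
           L \<subseteq> unsuccessful_indices \<theta> q F Fs S \<omega> \<longrightarrow>
           dense_in_unit_sphere (\<lambda>k. sgn (S k \<omega>)) L \<longrightarrow>
           ((\<lambda>k. X k \<omega>) \<longlongrightarrow> xstar) (along L) \<longrightarrow>
           clarke_stationary f xstar"
  using radius_tendsto_0 error_negligible step_nonzero AE_space
proof eventually_elim
  case (elim \<omega>)
  note nonzero = elim(3) and \<omega> = elim(4)
  show ?case
  proof (intro allI impI)
    fix L xstar
    assume L: "L \<subseteq> unsuccessful_indices \<theta> q F Fs S \<omega>"
        "dense_in_unit_sphere (\<lambda>k. sgn (S k \<omega>)) L" "((\<lambda>k. X k \<omega>) \<longlongrightarrow> xstar) (along L)"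
    obtain C where C: "lipschitz_around C f xstar"
      using assms unfolding locally_lipschitz_def by blast
    have step: "(\<lambda>k. S k \<omega>) \<longlonglongrightarrow> 0"
      using elim(1) by (rule Lim_null_comparison[rotated]) (simp add: norm_S_le[OF \<omega>])
    have "(\<lambda>k. norm (S k \<omega>) powr (q - 1)) \<longlonglongrightarrow> 0"
      by (rule tendsto_zero_powrI[OF tendsto_norm_zero[OF step] tendsto_const]) (use params in auto)
    then have "(\<lambda>k. \<theta> * norm (S k \<omega>) powr (q - 1) + \<bar>err k \<omega>\<bar> / norm (S k \<omega>)) \<longlonglongrightarrow> \<theta> * 0 + 0"
      by (intro tendsto_intros elim(2))
    then have c: "(\<lambda>k. \<theta> * norm (S k \<omega>) powr (q - 1) + \<bar>err k \<omega>\<bar> / norm (S k \<omega>)) \<longlonglongrightarrow> 0"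
      by simp
    show "clarke_stationary f xstar"
    proof (rule clarke_stationary_of_dense_steps[OF C L(2,3) _ step c])
      show "S k \<omega> \<noteq> 0" for k
        using nonzero by blast
      fix k assume "k \<in> L"
      then have "F k \<omega> - Fs k \<omega> < \<theta> * norm (S k \<omega>) powr q"
        using L(1) by (auto simp: unsuccessful_indices_def successful_def)
      then have "decrease k \<omega> \<le> \<theta> * norm (S k \<omega>) powr q + \<bar>err k \<omega>\<bar>"
        unfolding err_def by linarith
      also have "\<dots> = (\<theta> * norm (S k \<omega>) powr (q - 1) + \<bar>err k \<omega>\<bar> / norm (S k \<omega>)) * norm (S k \<omega>)"
        using nonzero by (simp add: distrib_right powr_diff)
      finally show "f (X k \<omega>) - f (X k \<omega> + S k \<omega>) \<le> \<dots>"
        by (simp add: decrease_def)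
    qed
  qed
qed

end

lemma locally_lipschitz_imp_continuous:
  assumes "locally_lipschitz f" shows "continuous_on UNIV f"
proof -
  have "isCont f x" for x
  proof -
    obtain C e where "0 < e" "C-lipschitz_on (ball x e) f"
      using assms unfolding locally_lipschitz_def lipschitz_around_def by blast
    then show ?thesis
      using lipschitz_on_continuous_on continuous_on_eq_continuous_at[OF open_ball] centre_in_ball by blast
  qed
  then show ?thesis by (simp add: continuous_on_eq_continuous_at)
qed

theorem theorem4p6:
  fixes M :: "'w measure"
    and f :: "real ^ 'n \<Rightarrow> real"
    and x0 :: "real ^ 'n" and fstar \<delta>0 \<theta> \<tau> \<tau>b q Lf \<rho> \<epsilon> :: real
    and X G S :: "nat \<Rightarrow> 'w \<Rightarrow> real ^ 'n" and B :: "nat \<Rightarrow> 'w \<Rightarrow> real ^ 'n ^ 'n"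
    and \<Delta> F Fs :: "nat \<Rightarrow> 'w \<Rightarrow> real"
  assumes f_locally_lipschitz: "locally_lipschitz f"
    and f_bounded_below: "bdd_below (range f)"
    and f_inf: "(INF x. f x) = fstar"
    and algorithm: "stochastic_trust_region M x0 \<delta>0 \<theta> \<tau> \<tau>b q X \<Delta> G B S F Fs"
    and lipschitz_at_accumulation_points:
      "AE \<omega> in M. \<forall>x. accumulation_point (\<lambda>k. X k \<omega>) x \<longrightarrow> lipschitz_around Lf f x"
    and rho: "0 < \<rho>" "\<rho> \<le> 1"
    and model_bound:
      "\<And>k. AE \<omega> in M. onorm ((*v) (B k \<omega>)) \<le> 1 / \<rho> * (norm (G k \<omega>) / \<Delta> k \<omega>)"
    and eps: "0 < \<epsilon>"
    and accuracy:
      "\<And>k \<alpha>. 0 < \<alpha> \<Longrightarrow> AE \<omega> in M.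
         cond_prob_given M (past_algebra M F Fs G B k)
           (\<lambda>\<omega>. \<bar>F k \<omega> - Fs k \<omega> - (f (X k \<omega>) - f (X k \<omega> + S k \<omega>))\<bar>
                  \<ge> \<alpha> * norm (S k \<omega>) powr q) \<omega>
         \<le> \<epsilon> / \<alpha> powr (q / (q - 1))"
    and theta_bound:
      "\<theta> > (\<rho> powr q * tau_minus \<tau> q + tau_plus \<tau> q) * \<epsilon> powr (1 / conj_exponent q)
             / (\<rho> powr q * tau_minus \<tau> q)"
  shows "AE \<omega> in M. \<forall>L xstar.
           L \<subseteq> unsuccessful_indices \<theta> q F Fs S \<omega> \<longrightarrow>
           dense_in_unit_sphere (\<lambda>k. sgn (S k \<omega>)) L \<longrightarrow>
           ((\<lambda>k. X k \<omega>) \<longlongrightarrow> xstar) (along L) \<longrightarrow>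
           clarke_stationary f xstar"
proof -
  interpret stochastic_trust_region M x0 \<delta>0 \<theta> \<tau> \<tau>b q X \<Delta> G B S F Fs
    by (rule algorithm)
  interpret tail_bounded_trust_region M x0 \<delta>0 \<theta> \<tau> \<tau>b q X \<Delta> G B S F Fs f fstar \<rho> \<epsilon>
  proof
    show "continuous_on UNIV f"
      using f_locally_lipschitz by (rule locally_lipschitz_imp_continuous)
    show "fstar \<le> f x" for x
      using f_bounded_below by (auto simp: f_inf[symmetric] intro: cINF_lower)
  qed (use rho eps model_bound accuracy theta_bound in \<open>simp_all add: conj_exponent_def\<close>)
  show ?thesis
    using f_locally_lipschitz by (rule clarke_stationary_limits)
qed

end
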